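(* Let $G$ be a cubic graph. Then the hexagon graph $H$ of $G$ is a brace if and only if $G$ is bridgeless.
   Context: Graphs $G$ are finite and simple; cubic means every vertex has degree 3, and bridgeless means that no edge of $G$ is a bridge (an edge whose deletion increases the number of connected components). **Brace.** A brace is a simple (no loops, no multiple edges), connected, bipartite graph on at least six vertices, with a perfect matching, such that for every pair of nonadjacent edges (edges with no common end vertex) there is a perfect matching containing both edges. **Hexagon graph.** Let $G$ be a cubic graph with vertex set $V$ and edge set $E$. A hexagon graph $H$ of $G$ is built as follows. (1) Each $v\in V$ is replaced by a copy $h_v$ of $K_{3,3}$ (a "hexagon"), the $h_v$ being pairwise vertex disjoint, with $V(H)=\bigcup_{v\in V}V(h_v)$. (2) For each $v$, write $V(h_v)=\{v_i: i\in\mathbb{Z}_6\}$ and $E(h_v)=\{v_iv_{i+1},\,v_iv_{i+3}: i\in\mathbb{Z}_6\}$. To each neighbour $u$ of $v$ in $G$ assign an index $i_{v(u)}\in\{0,1,2\}\subset\mathbb{Z}_6$ so that the three neighbours of $v$ get pairwise distinct indices. (3) Let $X=\bigcup_{v\in V}\{v_0,v_2,v_4\}$ and $Y=\bigcup_{v\in V}\{v_1,v_3,v_5\}$. Each edge $uv\in E$ is replaced by two vertex disjoint edges $e_{uv},e'_{uv}$: if $v_{i_{v(u)}}$ and $u_{i_{u(v)}}$ both belong to $X$ or both belong to $Y$, then $e_{uv}=v_{i_{v(u)}}u_{i_{u(v)}+3}$ and $e'_{uv}=v_{i_{v(u)}+3}u_{i_{u(v)}}$; otherwise $e_{uv}=v_{i_{v(u)}}u_{i_{u(v)}}$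 and $e'_{uv}=v_{i_{v(u)}+3}u_{i_{u(v)}+3}$. Finally $E(H)=\bigcup_{v\in V}E(h_v)\cup\{e_{uv},e'_{uv}:uv\in E\}$. All hexagon graphs of $G$ are isomorphic, so one speaks of the hexagon graph of $G$.
   Formalization: The equivalence is stated for connected nonempty cubic G, since a brace is connected and two disjoint copies of K4 (bridgeless) refute the claim as written; that H a brace implies G bridgeless is kept for every cubic G. *)

theory Defs
  imports Main
begin

record 'a ugraph =
  verts :: "'a set"
  edges :: "'a set set"

definition simple_graph :: "'a ugraph \<Rightarrow> bool" where
  "simple_graph G \<longleftrightarrow> finite (verts G) \<and> (\<forall>e\<in>edges G. e \<subseteq> verts G \<and> card e = 2)"

definition neighbours :: "'a ugraph \<Rightarrow> 'a \<Rightarrow> 'a set" where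
  "neighbours G v = {u. {u, v} \<in> edges G}"

definition degree :: "'a ugraph \<Rightarrow> 'a \<Rightarrow> nat" where
  "degree G v = card {e \<in> edges G. v \<in> e}"

definition cubic :: "'a ugraph \<Rightarrow> bool" where
  "cubic G \<longleftrightarrow> (\<forall>v\<in>verts G. degree G v = 3)"

definition reachable :: "'a ugraph \<Rightarrow> 'a rel" where
  "reachable G = {(u, v). u \<in> verts G \<and> v \<in> verts G \<and> (u, v) \<in> {(x, y). {x, y} \<in> edges G}\<^sup>*}"

definition components :: "'a ugraph \<Rightarrow> 'a set set" where
  "components G = verts G // reachable G"

definition connected_graph :: "'a ugraph \<Rightarrow> bool" where
  "connected_graph G \<longleftrightarrow>
     verts G \<noteq> {} \<and> (\<forall>u\<in>verts G. \<forall>v\<in>verts G. (u, v) \<in> reachable G)"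

definition delete_edge :: "'a ugraph \<Rightarrow> 'a set \<Rightarrow> 'a ugraph" where
  "delete_edge G e = G\<lparr>edges := edges G - {e}\<rparr>"

definition bridge :: "'a ugraph \<Rightarrow> 'a set \<Rightarrow> bool" where
  "bridge G e \<longleftrightarrow>
     e \<in> edges G \<and> card (components G) < card (components (delete_edge G e))"

definition bridgeless :: "'a ugraph \<Rightarrow> bool" where
  "bridgeless G \<longleftrightarrow> (\<forall>e\<in>edges G. \<not> bridge G e)"

definition bipartite :: "'a ugraph \<Rightarrow> bool" where
  "bipartite G \<longleftrightarrow>
     (\<exists>A B. A \<union> B = verts G \<and> A \<inter> B = {} \<and> (\<forall>e\<in>edges G. \<exists>a\<in>A. \<exists>b\<in>B. e = {a, b}))"

definition perfect_matching :: "'a ugraph \<Rightarrow> 'a set set \<Rightarrow> bool" where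
  "perfect_matching G M \<longleftrightarrow> M \<subseteq> edges G \<and> (\<forall>v\<in>verts G. \<exists>!e. e \<in> M \<and> v \<in> e)"

definition brace :: "'a ugraph \<Rightarrow> bool" where
  "brace G \<longleftrightarrow>
     simple_graph G \<and> connected_graph G \<and> bipartite G \<and> card (verts G) \<ge> 6 \<and>
     (\<exists>M. perfect_matching G M) \<and>
     (\<forall>e\<in>edges G. \<forall>f\<in>edges G. e \<inter> f = {} \<longrightarrow>
        (\<exists>M. perfect_matching G M \<and> e \<in> M \<and> f \<in> M))"

text \<open>
  In the hexagon graph the vertex \<open>v\<^sub>j\<close> of the hexagon at \<open>v\<close> is the pair \<open>(v, j)\<close>, where \<open>j < 6\<close>
  represents an element of the integers modulo 6.  The index that \<open>v\<close> assigns to its neighbour \<open>u\<close>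
  is \<open>ix v u\<close>.
\<close>

definition hexagon_verts :: "'a \<Rightarrow> ('a \<times> nat) set" where
  "hexagon_verts v = {(v, j) | j. j < 6}"

definition hexagon_edges :: "'a \<Rightarrow> ('a \<times> nat) set set" where
  "hexagon_edges v =
     {{(v, j), (v, (j + 1) mod 6)} | j. j < 6} \<union> {{(v, j), (v, (j + 3) mod 6)} | j. j < 6}"

definition hexagon_X :: "'a ugraph \<Rightarrow> ('a \<times> nat) set" where
  "hexagon_X G = (\<Union>v\<in>verts G. {(v, 0), (v, 2), (v, 4)})"

definition hexagon_Y :: "'a ugraph \<Rightarrow> ('a \<times> nat) set" where
  "hexagon_Y G = (\<Union>v\<in>verts G. {(v, 1), (v, 3), (v, 5)})"

definition index_assignment :: "'a ugraph \<Rightarrow> ('a \<Rightarrow> 'a \<Rightarrow> nat) \<Rightarrow> bool" where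
  "index_assignment G ix \<longleftrightarrow>
     (\<forall>v\<in>verts G. ix v ` neighbours G v \<subseteq> {0, 1, 2} \<and> inj_on (ix v) (neighbours G v))"

text \<open>
  The two edges replacing the edge \<open>uv\<close>; the set is symmetric in \<open>u\<close> and \<open>v\<close>.
\<close>

definition link_edges ::
  "'a ugraph \<Rightarrow> ('a \<Rightarrow> 'a \<Rightarrow> nat) \<Rightarrow> 'a \<Rightarrow> 'a \<Rightarrow> ('a \<times> nat) set set" where
  "link_edges G ix u v =
     (let p = ix v u; q = ix u v in
      if {(v, p), (u, q)} \<subseteq> hexagon_X G \<or> {(v, p), (u, q)} \<subseteq> hexagon_Y G
      then {{(v, p), (u, (q + 3) mod 6)}, {(v, (p + 3) mod 6), (u, q)}}
      else {{(v, p), (u, q)}, {(v, (p + 3) mod 6), (u, (q + 3) mod 6)}})"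

definition hexagon_graph :: "'a ugraph \<Rightarrow> ('a \<Rightarrow> 'a \<Rightarrow> nat) \<Rightarrow> ('a \<times> nat) ugraph" where
  "hexagon_graph G ix =
     \<lparr>verts = (\<Union>v\<in>verts G. hexagon_verts v),
      edges = (\<Union>v\<in>verts G. hexagon_edges v) \<union>
              \<Union>{link_edges G ix u v | u v. {u, v} \<in> edges G}\<rparr>"

definition is_hexagon_graph :: "'a ugraph \<Rightarrow> ('a \<times> nat) ugraph \<Rightarrow> bool" where
  "is_hexagon_graph G H \<longleftrightarrow> (\<exists>ix. index_assignment G ix \<and> H = hexagon_graph G ix)"

end

theory Submission
  imports Defs "HOL-Library.Transitive_Closure_Table" "HOL-Combinatorics.Transposition"
begin

text \<open>
  Identify both colour classes of \<open>H\<close> with the set of darts (oriented edges) of \<open>G\<close>.  A perfect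
  matching of \<open>H\<close> is then a permutation of the darts that sends every dart either to a dart with the
  same tail (a hexagon edge) or to its own reversal (a link edge).

  If \<open>uv\<close> is a bridge and \<open>U\<close> is the side of \<open>u\<close>, a permutation reversing \<open>(u, v)\<close> and sending some
  \<open>(u, w)\<close> to \<open>(u, v)\<close> would inject the darts with tail outside \<open>U\<close> into themselves without hitting
  \<open>(v, u)\<close>, which is impossible.

  Conversely, two disjoint hexagon edges, or two disjoint link edges, extend by permutations that
  differ from the identity by transpositions or reversals.  For a link edge over \<open>uv\<close> and a hexagon
  edge, reversing both darts of \<open>uv\<close> suffices, unless the hexagon edge blocks the second reversal; then
  one reverses instead the darts of a directed cycle through \<open>(u, v)\<close>, which exists as \<open>uv\<close> is not a
  bridge.
\<close>

section \<open>Closing a path into a cyclic permutation\<close>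

text \<open>The permutation runs along a repetition-free path from \<open>x\<close> to
  \<open>y\<close> and jumps from \<open>y\<close> back to \<open>x\<close>. Only this closing jump
  need not be an \<open>r\<close>-step.\<close>

lemma cycle_permutation:
  assumes "(x, y) \<in> {(a, b). r a b}\<^sup>*"
  obtains s where "bij s" "s y = x" "\<And>a. a \<noteq> y \<Longrightarrow> s a = a \<or> r a (s a)"
proof -
  \<comment> \<open>Fixing everything off the path strengthens the induction: with distinctness it
    makes the new first vertex a fixed point of the old permutation.\<close>
  have "\<exists>s. bij s \<and> s y = x \<and> (\<forall>a. a \<noteq> y \<longrightarrow> s a = a \<or> r a (s a)) \<and> (\<forall>a. a \<notin> set (x # xs) \<longrightarrow> s a = a)"
    if "rtrancl_path r x xs y" "distinct (x # xs)" for xs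
    using that
  proof (induction rule: rtrancl_path.induct)
    case (base x)
    show ?case by (rule exI[of _ id]) (simp add: bij_id[unfolded id_def] id_def)
  next
    case (step x z ys y)
    then obtain s where s: "bij s" "s y = z" "\<forall>a. a \<noteq> y \<longrightarrow> s a = a \<or> r a (s a)"
      "\<forall>a. a \<notin> set (z # ys) \<longrightarrow> s a = a" by auto
    have sx: "s x = x" using s(4) step.prems by auto
    have inj: "s a = s b \<longleftrightarrow> a = b" for a b using s(1) by (simp add: bij_def inj_eq)
    \<comment> \<open>This inserts \<open>x\<close> into the cycle: \<open>y\<close> now goes to
      \<open>x\<close> instead of \<open>z\<close>, and \<open>x\<close>, fixed by \<open>s\<close>,
      goes to \<open>z\<close>.\<close>
    have "bij (transpose x z \<circ> s)" using s(1) by (simp add: bij_comp)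
    moreover have "(transpose x z \<circ> s) a = a \<or> r a ((transpose x z \<circ> s) a)" if "a \<noteq> y" for a
    proof (cases "a = x")
      case True
      then show ?thesis using sx step.hyps by simp
    next
      case False
      then have "s a \<noteq> x" "s a \<noteq> z" using sx s(2) inj that by metis+
      then show ?thesis using s(3) that by auto
    qed
    moreover have "(transpose x z \<circ> s) a = a" if "a \<notin> set (x # z # ys)" for a
      using that s(4) by auto
    moreover have "(transpose x z \<circ> s) y = x" using s(2) by simp
    ultimately show ?case by blast
  qed
  moreover have "r\<^sup>*\<^sup>* x y" using assms by (simp add: rtranclp_rtrancl_eq)
  then obtain xs where "rtrancl_path r x xs y"
    by (auto simp: rtranclp_eq_rtrancl_path)
  then obtain xs' where "rtrancl_path r x xs' y" "distinct (x # xs')"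
    by (rule rtrancl_path_distinct)
  ultimately show ?thesis using that by blast
qed

section \<open>Bridges in terms of reachability\<close>

lemma reachable_delete_edge_eq:
  assumes "{u, v} \<in> edges G" "(u, v) \<in> reachable (delete_edge G {u, v})"
  shows "reachable (delete_edge G {u, v}) = reachable G"
proof -
  let ?R = "{(x, y). {x, y} \<in> edges G}" and ?S = "{(x, y). {x, y} \<in> edges G - {{u, v}}}"
  have "(u, v) \<in> ?S\<^sup>*" using assms(2) by (simp add: reachable_def delete_edge_def)
  moreover have "sym ?S" by (auto simp: sym_def insert_commute)
  ultimately have "(u, v) \<in> ?S\<^sup>*" "(v, u) \<in> ?S\<^sup>*" using sym_rtrancl symD by metis+
  then have "?R \<subseteq> ?S\<^sup>*" by (auto simp: doubleton_eq_iff)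
  moreover have "?S \<subseteq> ?R" by auto
  ultimately have "?R\<^sup>* = ?S\<^sup>*" using rtrancl_subset by blast
  then show ?thesis by (simp add: reachable_def delete_edge_def)
qed

lemma bridge_not_reachable:
  assumes "bridge G {u, v}"
  shows "(u, v) \<notin> reachable (delete_edge G {u, v})"
proof
  assume "(u, v) \<in> reachable (delete_edge G {u, v})"
  then have "reachable (delete_edge G {u, v}) = reachable G"
    using assms by (intro reachable_delete_edge_eq) (simp_all add: bridge_def)
  then have "components (delete_edge G {u, v}) = components G"
    by (simp add: components_def delete_edge_def)
  with assms show False by (simp add: bridge_def)
qed

text \<open>Connectedness leaves at most one component before the deletion, while separated ends
  would give two distinct classes after it.\<close>

lemma not_bridge_reachable:
  assumes G: "simple_graph G" "connected_graph G"
    and e: "{u, v} \<in> edges G" "\<not> bridge G {u, v}"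
  shows "(u, v) \<in> reachable (delete_edge G {u, v})"
proof (rule ccontr)
  let ?R = "reachable (delete_edge G {u, v})"
  assume n: "(u, v) \<notin> ?R"
  have V: "u \<in> verts G" "v \<in> verts G" "finite (verts G)" using G e by (auto simp: simple_graph_def)
  have "components G \<subseteq> {verts G}"
    using G(2) by (auto simp: components_def quotient_def connected_graph_def reachable_def)
  then have 1: "card (components G) \<le> 1" by (metis card.empty card_mono finite.emptyI finite_insert
    is_singletonI is_singleton_altdef)
  have sub: "{?R `` {u}, ?R `` {v}} \<subseteq> components (delete_edge G {u, v})"
    using V by (auto simp: components_def quotient_def delete_edge_def)
  have "v \<in> ?R `` {v}" using V by (simp add: reachable_def delete_edge_def)
  with n have "?R `` {u} \<noteq> ?R `` {v}" by blast
  then have 2: "card {?R `` {u}, ?R `` {v}} = 2" by simp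
  have "components (delete_edge G {u, v}) \<subseteq> Pow (verts G)"
    by (auto simp: components_def quotient_def reachable_def delete_edge_def)
  then have "finite (components (delete_edge G {u, v}))"
    using V(3) finite_subset by blast
  from card_mono[OF this sub] 1 2 e show False by (simp add: bridge_def)
qed

section \<open>The hexagon graph in terms of darts\<close>

locale hexagonal =
  fixes G :: "'a ugraph" and ix :: "'a \<Rightarrow> 'a \<Rightarrow> nat"
  assumes simple: "simple_graph G" and cubic: "cubic G" and ix: "index_assignment G ix"
begin

definition darts :: "('a \<times> 'a) set" where
  "darts = {(v, u). {v, u} \<in> edges G}"

text \<open>An index \<open>i\<close> in {0, 1, 2} owns the antipodal vertices \<open>i\<close> and
  \<open>i + 3\<close> of its hexagon, one even and one odd. \<open>xport\<close> picks the even one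
  and \<open>yport\<close> the odd one, so darts label both colour classes.\<close>

definition xport :: "'a \<times> 'a \<Rightarrow> 'a \<times> nat" where
  "xport d = (fst d, (let i = ix (fst d) (snd d) in if even i then i else i + 3))"

definition yport :: "'a \<times> 'a \<Rightarrow> 'a \<times> nat" where
  "yport d = (fst d, (let i = ix (fst d) (snd d) in if even i then i + 3 else i))"

abbreviation H :: "('a \<times> nat) ugraph" where "H \<equiv> hexagon_graph G ix"

text \<open>For darts this will be the adjacency of \<open>xport d\<close> and
  \<open>yport d'\<close>, see \<open>edges_H\<close>: a shared tail means a hexagon edge, a
  reversal means a link edge.\<close>

abbreviation linked :: "'a \<times> 'a \<Rightarrow> 'a \<times> 'a \<Rightarrow> bool" where
  "linked d d' \<equiv> fst d' = fst d \<or> d' = prod.swap d"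

lemma edge_verts: "{u, v} \<in> edges G \<Longrightarrow> u \<in> verts G \<and> v \<in> verts G \<and> u \<noteq> v"
  using simple by (auto simp: simple_graph_def card_2_iff doubleton_eq_iff)

lemma swap_darts [simp]: "prod.swap d \<in> darts \<longleftrightarrow> d \<in> darts"
  by (cases d) (simp add: darts_def insert_commute)

lemma swap_neq: "d \<in> darts \<Longrightarrow> fst d \<noteq> snd d"
  using edge_verts by (auto simp: darts_def)

lemma dart_verts: "d \<in> darts \<Longrightarrow> fst d \<in> verts G"
  using edge_verts by (auto simp: darts_def)

lemma darts_neighbours: "(v, u) \<in> darts \<longleftrightarrow> u \<in> neighbours G v"
  by (simp add: darts_def neighbours_def insert_commute)

lemma finite_darts: "finite darts"
proof (rule finite_subset)
  show "darts \<subseteq> verts G \<times> verts G" using edge_verts by (auto simp: darts_def)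
  show "finite (verts G \<times> verts G)" using simple by (auto simp: simple_graph_def)
qed

lemma card_neighbours:
  assumes "v \<in> verts G" shows "card (neighbours G v) = 3"
proof -
  have "{e \<in> edges G. v \<in> e} = (\<lambda>u. {u, v}) ` neighbours G v"
  proof (intro subset_antisym subsetI)
    fix e assume e: "e \<in> {e \<in> edges G. v \<in> e}"
    then have "card e = 2" using simple by (auto simp: simple_graph_def)
    then obtain u where "e = {u, v}" using e by (auto simp: card_2_iff)
    with e show "e \<in> (\<lambda>u. {u, v}) ` neighbours G v" by (auto simp: neighbours_def)
  qed (auto simp: neighbours_def)
  moreover have "inj_on (\<lambda>u. {u, v}) (neighbours G v)"
    by (auto simp: inj_on_def doubleton_eq_iff)
  moreover have "card {e \<in> edges G. v \<in> e} = 3"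
    using cubic assms by (simp add: cubic_def degree_def)
  ultimately show ?thesis by (metis card_image)
qed

text \<open>Three neighbours receive distinct indices among three values.\<close>

lemma ix_surj:
  assumes "v \<in> verts G" shows "ix v ` neighbours G v = {0, 1, 2}"
proof -
  note 1 = bspec[OF ix[unfolded index_assignment_def] assms]
  then have "card (ix v ` neighbours G v) = card {0, 1, 2::nat}"
    using card_neighbours[OF assms] by (simp add: card_image)
  then show ?thesis by (intro card_subset_eq[OF _ conjunct1[OF 1]]) simp_all
qed

lemma ix_range: "(v, u) \<in> darts \<Longrightarrow> ix v u \<in> {0, 1, 2}"
  using ix_surj[of v] dart_verts[of "(v, u)"] by (metis darts_neighbours fst_conv imageI)

lemma ix_inj: "(v, u) \<in> darts \<Longrightarrow> (v, w) \<in> darts \<Longrightarrow> ix v u = ix v w \<Longrightarrow> u = w"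
  using ix dart_verts[of "(v, u)"] unfolding index_assignment_def darts_neighbours
  by (metis fst_conv inj_onD)

lemma xport_eq_iff:
  assumes "d \<in> darts" "d' \<in> darts" shows "xport d = xport d' \<longleftrightarrow> d = d'"
proof (cases d; cases d')
  fix v u v' u' assume d: "d = (v, u)" "d' = (v', u')"
  have "xport d = xport d' \<longleftrightarrow> v = v' \<and> ix v u = ix v' u'"
    using ix_range[of v u] ix_range[of v' u'] assms unfolding d by (auto simp: xport_def)
  then show ?thesis using ix_inj[of v u u'] assms d by auto
qed

lemma yport_eq_iff:
  assumes "d \<in> darts" "d' \<in> darts" shows "yport d = yport d' \<longleftrightarrow> d = d'"
proof (cases d; cases d')
  fix v u v' u' assume d: "d = (v, u)" "d' = (v', u')"
  have "yport d = yport d' \<longleftrightarrow> v = v' \<and> ix v u = ix v' u'"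
    using ix_range[of v u] ix_range[of v' u'] assms unfolding d by (auto simp: yport_def)
  then show ?thesis using ix_inj[of v u u'] assms d by auto
qed

lemma xport_neq_yport: "xport d \<noteq> yport d'"
proof
  assume "xport d = yport d'"
  then have "even (snd (xport d)) = even (snd (yport d'))" by simp
  then show False by (simp add: xport_def yport_def Let_def split: if_splits)
qed

lemma port_edge_eq_iff:
  assumes "d \<in> darts" "d' \<in> darts" "b \<in> darts" "b' \<in> darts"
  shows "{xport d, yport d'} = {xport b, yport b'} \<longleftrightarrow> d = b \<and> d' = b'"
  using assms xport_eq_iff yport_eq_iff xport_neq_yport
  by (metis doubleton_eq_iff)

lemma xports:
  assumes "v \<in> verts G" shows "xport ` {d \<in> darts. fst d = v} = {(v, 0), (v, 2), (v, 4)}"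
proof -
  have "xport ` {d \<in> darts. fst d = v} = (\<lambda>i. (v, if even i then i else i + 3)) ` ix v ` neighbours G v"
    by (force simp: xport_def Let_def darts_neighbours image_iff)
  then show ?thesis using ix_surj[OF assms] by auto
qed

lemma yports:
  assumes "v \<in> verts G" shows "yport ` {d \<in> darts. fst d = v} = {(v, 1), (v, 3), (v, 5)}"
proof -
  have "yport ` {d \<in> darts. fst d = v} = (\<lambda>i. (v, if even i then i + 3 else i)) ` ix v ` neighbours G v"
    by (force simp: yport_def Let_def darts_neighbours image_iff)
  then show ?thesis using ix_surj[OF assms] by auto
qed

lemma less6: "{j. j < (6::nat)} = {0, 1, 2, 3, 4, 5}"
  by auto

lemma verts_H: "verts H = xport ` darts \<union> yport ` darts"
proof -
  have "xport ` darts = (\<Union>v\<in>verts G. xport ` {d \<in> darts. fst d = v})"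
    "yport ` darts = (\<Union>v\<in>verts G. yport ` {d \<in> darts. fst d = v})"
    using dart_verts by auto
  moreover have "hexagon_verts v = {(v, 0), (v, 2), (v, 4)} \<union> {(v, 1), (v, 3), (v, 5)}" for v :: 'a
  proof -
    have "hexagon_verts v = Pair v ` {j. j < 6}" by (auto simp: hexagon_verts_def)
    then show ?thesis unfolding less6 by auto
  qed
  ultimately show ?thesis using xports yports
    by (simp add: hexagon_graph_def UN_Un_distrib del: Un_insert_left Un_insert_right)
qed

text \<open>Modulo 6, an even and an odd residue differ by 1, -1 or 3, so the hexagon is the
  complete bipartite graph between its even and odd vertices.\<close>

lemma hexagon_edges_eq:
  assumes "v \<in> verts G"
  shows "hexagon_edges v =
    {{xport d, yport d'} | d d'. d \<in> darts \<and> d' \<in> darts \<and> fst d = v \<and> fst d' = v}"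
proof -
  have "{{xport d, yport d'} | d d'. d \<in> darts \<and> d' \<in> darts \<and> fst d = v \<and> fst d' = v}
    = (\<Union>a \<in> xport ` {d \<in> darts. fst d = v}. \<Union>b \<in> yport ` {d \<in> darts. fst d = v}. {{a, b}})"
    by blast
  also have "\<dots> = (\<lambda>j. {(v, j), (v, (j + 1) mod 6)}) ` {j. j < 6} \<union>
      (\<lambda>j. {(v, j), (v, (j + 3) mod 6)}) ` {j. j < 6}"
    unfolding xports[OF assms] yports[OF assms] less6
    by (simp add: insert_commute numeral_2_eq_2[symmetric])
  also have "\<dots> = hexagon_edges v" by (auto simp: hexagon_edges_def)
  finally show ?thesis by simp
qed

text \<open>The case distinction in \<open>link_edges\<close> exists to join opposite colours; in
  all nine index combinations each end's even vertex meets the other end's odd vertex.\<close>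

lemma link_edges_eq:
  assumes "{u, v} \<in> edges G"
  shows "link_edges G ix u v = {{xport (v, u), yport (u, v)}, {xport (u, v), yport (v, u)}}"
proof -
  have d: "(u, v) \<in> darts" "(v, u) \<in> darts" using assms by (auto simp: darts_def insert_commute)
  have XY: "(w, j) \<in> hexagon_X G \<longleftrightarrow> w \<in> verts G \<and> j \<in> {0, 2, 4}"
    "(w, j) \<in> hexagon_Y G \<longleftrightarrow> w \<in> verts G \<and> j \<in> {1, 3, 5}" for w j
    by (auto simp: hexagon_X_def hexagon_Y_def)
  show ?thesis using edge_verts[OF assms] ix_range[OF d(1)] ix_range[OF d(2)]
    by (elim insertE emptyE)
      (simp_all add: link_edges_def xport_def yport_def XY insert_commute)
qed

lemma edges_H:
  "edges H = {{xport d, yport d'} | d d'. d \<in> darts \<and> d' \<in> darts \<and> linked d d'}" (is "_ = ?R")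
proof (intro subset_antisym subsetI)
  fix e assume "e \<in> edges H"
  then consider v where "v \<in> verts G" "e \<in> hexagon_edges v"
    | u v where "{u, v} \<in> edges G" "e \<in> link_edges G ix u v"
    by (auto simp: hexagon_graph_def)
  then show "e \<in> ?R"
  proof cases
    case 1
    then show ?thesis unfolding hexagon_edges_eq[OF 1(1)] by blast
  next
    case (2 u v)
    then have "(u, v) \<in> darts" "(v, u) \<in> darts" by (auto simp: darts_def insert_commute)
    moreover have "linked (v, u) (u, v)" "linked (u, v) (v, u)" by simp_all
    ultimately show ?thesis using 2 unfolding link_edges_eq[OF 2(1)] by blast
  qed
next
  fix e assume "e \<in> ?R"
  then obtain d d' where d: "e = {xport d, yport d'}" "d \<in> darts" "d' \<in> darts" "linked d d'" by auto
  show "e \<in> edges H"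
  proof (cases "fst d' = fst d")
    case True
    then have "e \<in> hexagon_edges (fst d)" "fst d \<in> verts G"
      using d unfolding hexagon_edges_eq[OF dart_verts[OF d(2)]] by (blast, simp add: dart_verts)
    then show ?thesis by (auto simp: hexagon_graph_def)
  next
    case False
    obtain u v where uv: "d = (u, v)" by (cases d)
    then have "{u, v} \<in> edges G" "e \<in> link_edges G ix u v"
      using d False link_edges_eq by (auto simp: darts_def)
    then show ?thesis by (auto simp: hexagon_graph_def)
  qed
qed

lemma edge_H_I: "d \<in> darts \<Longrightarrow> d' \<in> darts \<Longrightarrow> linked d d' \<Longrightarrow> {xport d, yport d'} \<in> edges H"
  unfolding edges_H by blast

section \<open>Perfect matchings as permutations of darts\<close>

text \<open>\<open>p\<close> sends the label of an X-vertex to the label of its partner in Y.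
  Injectivity is enough, because finiteness of \<open>darts\<close> turns it into
  surjectivity.\<close>

definition dart_matching :: "('a \<times> 'a \<Rightarrow> 'a \<times> 'a) \<Rightarrow> bool" where
  "dart_matching p \<longleftrightarrow> inj_on p darts \<and> (\<forall>d\<in>darts. p d \<in> darts \<and> linked d (p d))"

lemma dart_matching_surj: "dart_matching p \<Longrightarrow> p ` darts = darts"
  unfolding dart_matching_def using finite_darts by (intro endo_inj_surj) auto

lemma perfect_matching_of_dart_matching:
  assumes "dart_matching p"
  shows "perfect_matching H ((\<lambda>d. {xport d, yport (p d)}) ` darts)" (is "perfect_matching H ?M")
  unfolding perfect_matching_def
proof (intro conjI ballI)
  have p: "\<And>d. d \<in> darts \<Longrightarrow> p d \<in> darts" "\<And>d. d \<in> darts \<Longrightarrow> linked d (p d)" "inj_on p darts"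
    using assms by (auto simp: dart_matching_def)
  show "?M \<subseteq> edges H" using p edge_H_I by blast
  fix z assume "z \<in> verts H"
  then consider d where "d \<in> darts" "z = xport d" | d where "d \<in> darts" "z = yport d"
    unfolding verts_H by blast
  then show "\<exists>!e. e \<in> ?M \<and> z \<in> e"
  proof cases
    case (1 d)
    have "c = d" if "c \<in> darts" "z \<in> {xport c, yport (p c)}" for c
    proof -
      have "xport c = xport d" using that(2) 1(2) xport_neq_yport[of d "p c"] by simp
      then show ?thesis using xport_eq_iff[OF that(1) 1(1)] by blast
    qed
    then show ?thesis using 1 by (intro ex1I[of _ "{xport d, yport (p d)}"]) (simp, blast)
  next
    case (2 d)
    then obtain c where c: "c \<in> darts" "d = p c" using dart_matching_surj[OF assms] by blast
    have "b = c" if "b \<in> darts" "z \<in> {xport b, yport (p b)}" for b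
    proof -
      have "yport (p b) = yport (p c)" using that(2) 2(2) c(2) xport_neq_yport[of b "p c"] by simp
      then have "p b = p c" using yport_eq_iff[OF p(1)[OF that(1)] p(1)[OF c(1)]] by blast
      then show ?thesis using inj_onD[OF p(3)] that(1) c(1) by blast
    qed
    then show ?thesis using 2 c by (intro ex1I[of _ "{xport c, yport (p c)}"]) (simp, blast)
  qed
qed

lemma dart_matching_of_perfect_matching:
  assumes M: "perfect_matching H M"
  obtains p where "dart_matching p" "\<And>d d'. d \<in> darts \<Longrightarrow> d' \<in> darts \<Longrightarrow> {xport d, yport d'} \<in> M \<Longrightarrow> p d = d'"
proof -
  have uniq: "e = f" if "e \<in> M" "f \<in> M" "z \<in> e" "z \<in> f" "z \<in> verts H" for e f z
    using M that unfolding perfect_matching_def by blast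
  \<comment> \<open>The matching edge at the X-vertex of \<open>d\<close> supplies the value of
    \<open>p\<close> at \<open>d\<close>.\<close>
  have ex: "\<exists>d'. d' \<in> darts \<and> linked d d' \<and> {xport d, yport d'} \<in> M" if d: "d \<in> darts" for d
  proof -
    have "xport d \<in> verts H" using d by (simp add: verts_H)
    then obtain e where e: "e \<in> M" "xport d \<in> e" using M unfolding perfect_matching_def by blast
    then have "e \<in> edges H" using M by (auto simp: perfect_matching_def)
    then obtain b b' where b: "e = {xport b, yport b'}" "b \<in> darts" "b' \<in> darts" "linked b b'"
      unfolding edges_H by blast
    then have "b = d" using e d xport_eq_iff xport_neq_yport by auto
    then show ?thesis using b e by blast
  qed
  then obtain p where p: "\<And>d. d \<in> darts \<Longrightarrow> p d \<in> darts \<and> linked d (p d) \<and> {xport d, yport (p d)} \<in> M"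
    by metis
  have eq: "p d = d'" if "d \<in> darts" "d' \<in> darts" "{xport d, yport d'} \<in> M" for d d'
  proof -
    have "{xport d, yport d'} = {xport d, yport (p d)}"
      by (rule uniq[of _ _ "xport d"]) (use p that in \<open>simp_all add: verts_H\<close>)
    then show ?thesis using port_edge_eq_iff p that by blast
  qed
  have "inj_on p darts"
  proof (rule inj_onI)
    fix d b assume d: "d \<in> darts" "b \<in> darts" "p d = p b"
    have "{xport d, yport (p d)} = {xport b, yport (p b)}"
      by (rule uniq[of _ _ "yport (p d)"]) (use p[OF d(1)] p[OF d(2)] d in \<open>simp_all add: verts_H\<close>)
    then show "d = b" using port_edge_eq_iff p d by blast
  qed
  then have "dart_matching p" using p by (simp add: dart_matching_def)
  then show ?thesis using that eq by blast
qed

section \<open>Constructing dart matchings\<close>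

text \<open>Swapping the values \<open>d'\<close> and \<open>p d\<close> gives \<open>d\<close> the
  image \<open>d'\<close>, and the former preimage of \<open>d'\<close> receives \<open>p d\<close>.
  Both stay inside one hexagon, which is what the assumption on \<open>c\<close> secures.\<close>

lemma dart_matching_exchange:
  assumes p: "dart_matching p" and d: "d \<in> darts" "d' \<in> darts" "fst d' = fst d" "fst (p d) = fst d"
    and c: "\<And>c. c \<in> darts \<Longrightarrow> p c = d' \<Longrightarrow> fst c = fst d"
  obtains q where "dart_matching q" "q d = d'" "\<And>z. fst (q z) = fst (p z)"
    "\<And>z. z \<in> darts \<Longrightarrow> z \<noteq> d \<Longrightarrow> p z \<noteq> d' \<Longrightarrow> q z = p z"
proof
  let ?q = "transpose d' (p d) \<circ> p"
  have inj: "z = d" if "z \<in> darts" "p z = p d" for z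
    using p that d(1) by (auto simp: dart_matching_def inj_on_def)
  show fst: "fst (?q z) = fst (p z)" for z using d by (auto simp: transpose_def)
  show "?q d = d'" by (simp add: transpose_def)
  show "?q z = p z" if "z \<in> darts" "z \<noteq> d" "p z \<noteq> d'" for z
    using that inj[of z] by (auto simp: transpose_def)
  show "dart_matching ?q"
    unfolding dart_matching_def
  proof (intro conjI ballI)
    show "inj_on ?q darts"
      using p by (intro comp_inj_on) (auto simp: dart_matching_def intro: inj_on_subset)
    fix z assume z: "z \<in> darts"
    then have pz: "p z \<in> darts" "p d \<in> darts" "linked z (p z)"
      using p d by (auto simp: dart_matching_def)
    then show "?q z \<in> darts" using d by (auto simp: transpose_def)
    show "linked z (?q z)"
    proof (cases "p z = d' \<or> p z = p d")
      case True
      then have "fst (p z) = fst z" using inj c z d by metis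
      then show ?thesis using fst by simp
    next
      case False
      then show ?thesis using pz by (simp add: transpose_def)
    qed
  qed
qed

lemma dart_matching_reverse:
  assumes "\<And>d. d \<in> S \<Longrightarrow> prod.swap d \<in> S"
  shows "dart_matching (\<lambda>d. if d \<in> S then prod.swap d else d)"
  using assms by (auto simp: dart_matching_def inj_on_def)

text \<open>Reversing each forward dart \<open>(a, s a)\<close> takes up the backward dart at
  \<open>s a\<close> and frees \<open>(a, s a)\<close> itself. The backward dart at \<open>a\<close>
  is therefore sent to \<open>(a, s a)\<close>, a hexagon edge at \<open>a\<close>. A cycle of
  length two is covered by the first branch alone.\<close>

lemma dart_matching_cycle:
  assumes s: "bij s" "\<And>a. s a = a \<or> {a, s a} \<in> edges G"
  shows "dart_matching (\<lambda>(a, b). if b = s a then (b, a) else if s b = a then (a, s a) else (a, b))"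
    (is "dart_matching ?p")
proof -
  have inj: "s a = s b \<longleftrightarrow> a = b" for a b using s(1) by (simp add: bij_def inj_eq)
  have "inj_on ?p darts" by (auto simp: inj_on_def inj split: if_splits)
  moreover have "?p (a, b) \<in> darts \<and> linked (a, b) (?p (a, b))" if "(a, b) \<in> darts" for a b
    \<comment> \<open>In the second branch \<open>s\<close> moves \<open>a\<close>: otherwise
      \<open>s b = s a\<close> would force \<open>b = a\<close>, and a dart is not a loop.\<close>
    using that s(2)[of a] swap_neq[OF that] by (auto simp: darts_def insert_commute inj)
  ultimately show ?thesis unfolding dart_matching_def by auto
qed

text \<open>Two exchanges starting from the identity; the first preserves all tails, so the second
  applies, and \<open>neq\<close> keeps it from disturbing \<open>d\<close>.\<close>

lemma dart_matching_two_hexagon: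
  assumes "d \<in> darts" "d' \<in> darts" "fst d' = fst d" "b \<in> darts" "b' \<in> darts" "fst b' = fst b"
    and neq: "d \<noteq> b" "d' \<noteq> b'"
  obtains p where "dart_matching p" "p d = d'" "p b = b'"
proof -
  have "dart_matching id" by (auto simp: dart_matching_def)
  then obtain p where p: "dart_matching p" "p d = d'" "\<And>z. fst (p z) = fst z"
    by (rule dart_matching_exchange[of id d d']) (use assms in auto)
  obtain q where "dart_matching q" "q b = b'" "\<And>z. z \<in> darts \<Longrightarrow> z \<noteq> b \<Longrightarrow> p z \<noteq> b' \<Longrightarrow> q z = p z"
    by (rule dart_matching_exchange[OF p(1), of b b']) (use assms p(3) in auto)
  then show ?thesis using that p(2) assms by metis
qed

lemma dart_matching_link_hexagon:
  assumes conn: "\<And>u v. {u, v} \<in> edges G \<Longrightarrow> (u, v) \<in> reachable (delete_edge G {u, v})"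
    and d: "d \<in> darts" and b: "b \<in> darts" "b' \<in> darts" "fst b' = fst b"
    and neq: "d \<noteq> b" "prod.swap d \<noteq> b'"
  obtains p where "dart_matching p" "p d = prod.swap d" "p b = b'"
proof -
  obtain u v where uv: "d = (u, v)" by (cases d)
  obtain w x where wx: "b = (w, x)" by (cases b)
  obtain y where wy: "b' = (w, y)" using b(3) wx by (cases b') simp
  have e: "{u, v} \<in> edges G" "u \<noteq> v" using d uv edge_verts by (auto simp: darts_def)
  \<comment> \<open>The last two conjuncts are what an exchange needs to redirect \<open>b\<close>
    to \<open>b'\<close>; by \<open>neq\<close> that exchange leaves the image of \<open>d\<close>
    alone.\<close>
  have "\<exists>p. dart_matching p \<and> p d = prod.swap d \<and> fst (p b) = fst b \<and>
    (\<forall>c\<in>darts. p c = b' \<longrightarrow> fst c = fst b)"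
  \<comment> \<open>Reversing only \<open>d\<close> and its opposite fixes \<open>b\<close> and
    \<open>b'\<close> unless \<open>b\<close> is the opposite of \<open>d\<close> (its image then
    leaves the hexagon) or \<open>b'\<close> is \<open>d\<close> (its preimage then lies
    outside).\<close>
  proof (cases "b = prod.swap d \<or> b' = d")
    case False
    have "dart_matching (\<lambda>z. if z \<in> {d, prod.swap d} then prod.swap z else z)"
      by (rule dart_matching_reverse) auto
    then show ?thesis using False neq b(3)
      by (intro exI[of _ "\<lambda>z. if z \<in> {d, prod.swap d} then prod.swap z else z"]) auto
  next
    case True
    \<comment> \<open>A return path from \<open>v\<close> to \<open>u\<close> avoiding the edge
      closes up, through the step from \<open>u\<close> to \<open>v\<close>, to a directed
      cycle.\<close>
    have "(v, u) \<in> reachable (delete_edge G {v, u})" using conn[of v u] e by (simp add: insert_commute)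
    then have "(v, u) \<in> {(a, b). {a, b} \<in> edges G \<and> {a, b} \<noteq> {u, v}}\<^sup>*"
      by (simp add: reachable_def delete_edge_def insert_commute)
    then obtain s where s: "bij s" "s u = v"
      "\<And>a. a \<noteq> u \<Longrightarrow> s a = a \<or> {a, s a} \<in> edges G \<and> {a, s a} \<noteq> {u, v}"
      by (rule cycle_permutation[where r = "\<lambda>a b. {a, b} \<in> edges G \<and> {a, b} \<noteq> {u, v}"]) blast
    have inj: "s a = s b \<longleftrightarrow> a = b" for a b using s(1) by (simp add: bij_def inj_eq)
    \<comment> \<open>As the path avoids \<open>{u, v}\<close>, the dart \<open>(v, u)\<close> is
      not reversed: it goes to \<open>(v, s v)\<close>, and \<open>(u, v)\<close> is the image of a
      dart with tail \<open>u\<close>.\<close>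
    have sv: "s v \<noteq> u" using s(3)[of v] e(2) by auto
    let ?p = "\<lambda>(a, b). if b = s a then (b, a) else if s b = a then (a, s a) else (a, b)"
    have "s a = a \<or> {a, s a} \<in> edges G" for a using s(2,3) e by (cases "a = u") auto
    then have "dart_matching ?p" using s(1) by (intro dart_matching_cycle)
    moreover have "?p d = prod.swap d" using uv s(2) by simp
    moreover have "fst (?p b) = fst b" using True neq uv wx wy s(2) sv by auto
    moreover have "\<forall>c\<in>darts. ?p c = b' \<longrightarrow> fst c = fst b"
      using True neq uv wx wy s(2) sv by (auto simp: inj split: if_splits)
    ultimately show ?thesis by blast
  qed
  then obtain p where p: "dart_matching p" "p d = prod.swap d" "fst (p b) = fst b"
    "\<And>c. c \<in> darts \<Longrightarrow> p c = b' \<Longrightarrow> fst c = fst b" by blast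
  obtain q where "dart_matching q" "q b = b'" "\<And>z. z \<in> darts \<Longrightarrow> z \<noteq> b \<Longrightarrow> p z \<noteq> b' \<Longrightarrow> q z = p z"
    by (rule dart_matching_exchange[OF p(1) b p(3) p(4)]) auto
  then show ?thesis using that p(2) d neq by metis
qed

lemma dart_matching_two_link:
  obtains p where "dart_matching p" "p d = prod.swap d" "p b = prod.swap b"
proof
  let ?S = "{d, prod.swap d, b, prod.swap b}"
  show "dart_matching (\<lambda>z. if z \<in> ?S then prod.swap z else z)"
    by (rule dart_matching_reverse) auto
qed simp_all

section \<open>The defining conditions of a brace\<close>

lemma extend_two_edges:
  assumes conn: "\<And>u v. {u, v} \<in> edges G \<Longrightarrow> (u, v) \<in> reachable (delete_edge G {u, v})"
    and ef: "e \<in> edges H" "f \<in> edges H" "e \<inter> f = {}"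
  shows "\<exists>M. perfect_matching H M \<and> e \<in> M \<and> f \<in> M"
proof -
  obtain d d' where d: "e = {xport d, yport d'}" "d \<in> darts" "d' \<in> darts" "linked d d'"
    using ef(1) unfolding edges_H by blast
  obtain b b' where b: "f = {xport b, yport b'}" "b \<in> darts" "b' \<in> darts" "linked b b'"
    using ef(2) unfolding edges_H by blast
  have neq: "d \<noteq> b" "d' \<noteq> b'" using d b ef(3) by auto
  have "\<exists>p. dart_matching p \<and> p d = d' \<and> p b = b'"
    using d(4) b(4)
  proof (elim disjE)
    assume "fst d' = fst d" "fst b' = fst b"
    then show ?thesis using d b neq dart_matching_two_hexagon by metis
  next
    assume "fst d' = fst d" "b' = prod.swap b"
    then show ?thesis using dart_matching_link_hexagon[OF conn b(2) d(2,3)] neq by metis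
  next
    assume "d' = prod.swap d" "fst b' = fst b"
    then show ?thesis using dart_matching_link_hexagon[OF conn d(2) b(2,3)] neq by metis
  next
    assume "d' = prod.swap d" "b' = prod.swap b"
    then show ?thesis using dart_matching_two_link by metis
  qed
  then obtain p where "dart_matching p" "p d = d'" "p b = b'" by blast
  then show ?thesis using perfect_matching_of_dart_matching d b by blast
qed

lemma connected_H:
  assumes "connected_graph G" shows "connected_graph H"
proof -
  let ?S = "{(x, y). {x, y} \<in> edges H}"
  have sym: "sym (?S\<^sup>*)" by (rule sym_rtrancl) (simp add: sym_def insert_commute)
  have xy: "(xport d, yport d') \<in> ?S\<^sup>*" if "d \<in> darts" "d' \<in> darts" for d d'
  proof -
    \<comment> \<open>A walk in \<open>G\<close> lifts to \<open>H\<close>: from \<open>b\<close> to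
      \<open>c\<close> move to \<open>yport (b, c)\<close>, cross the link edge to
      \<open>xport (c, b)\<close>, then take a hexagon edge to any odd vertex at
      \<open>c\<close>.\<close>
    have "(a, b) \<in> {(x, y). {x, y} \<in> edges G}\<^sup>* \<Longrightarrow> fst d = a \<Longrightarrow>
      \<forall>d'\<in>darts. fst d' = b \<longrightarrow> (xport d, yport d') \<in> ?S\<^sup>*" for a b
    proof (induction rule: rtrancl_induct)
      case base
      then show ?case using edge_H_I[OF that(1)] by (intro ballI impI r_into_rtrancl) simp
    next
      case (step b c)
      show ?case
      proof (intro ballI impI)
        fix d' assume d': "d' \<in> darts" "fst d' = c"
        have bc: "(b, c) \<in> darts" "(c, b) \<in> darts"
          using step.hyps by (auto simp: darts_def insert_commute)
        have "(xport d, yport (b, c)) \<in> ?S\<^sup>*" using step bc by simp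
        moreover have "(yport (b, c), xport (c, b)) \<in> ?S"
          using edge_H_I[OF bc(2,1)] by (simp add: insert_commute)
        moreover have "(xport (c, b), yport d') \<in> ?S" using edge_H_I[OF bc(2) d'(1)] d'(2) by simp
        ultimately show "(xport d, yport d') \<in> ?S\<^sup>*" by (meson rtrancl.rtrancl_into_rtrancl)
      qed
    qed
    moreover have "(fst d, fst d') \<in> {(x, y). {x, y} \<in> edges G}\<^sup>*"
      using assms that dart_verts by (auto simp: connected_graph_def reachable_def)
    ultimately show ?thesis using that by blast
  qed
  have yx: "(yport d', xport d) \<in> ?S\<^sup>*" if "d \<in> darts" "d' \<in> darts" for d d'
    using xy[OF that] sym by (meson symD)
  have all: "(z, z') \<in> ?S\<^sup>*" if "z \<in> verts H" "z' \<in> verts H" for z z'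
    using that unfolding verts_H by (auto intro: xy yx rtrancl_trans[OF xy yx] rtrancl_trans[OF yx xy])
  obtain v where "v \<in> verts G" using assms by (auto simp: connected_graph_def)
  then have "(v, 0) \<in> verts H" by (auto simp: hexagon_graph_def hexagon_verts_def)
  then show ?thesis using all by (auto simp: connected_graph_def reachable_def)
qed

lemma simple_H: "simple_graph H"
  unfolding simple_graph_def
proof (intro conjI ballI)
  show "finite (verts H)" using finite_darts by (simp add: verts_H)
  fix e assume "e \<in> edges H"
  then obtain d d' where d: "e = {xport d, yport d'}" "d \<in> darts" "d' \<in> darts"
    unfolding edges_H by blast
  then show "e \<subseteq> verts H" by (simp add: verts_H)
  show "card e = 2" using d(1) xport_neq_yport[of d d'] by simp
qed

lemma bipartite_H: "bipartite H"
  unfolding bipartite_def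
proof (intro exI conjI)
  show "xport ` darts \<union> yport ` darts = verts H" by (simp add: verts_H)
  show "xport ` darts \<inter> yport ` darts = {}" using xport_neq_yport by blast
  show "\<forall>e\<in>edges H. \<exists>a\<in>xport ` darts. \<exists>b\<in>yport ` darts. e = {a, b}" unfolding edges_H by blast
qed

lemma card_verts_H:
  assumes "verts G \<noteq> {}" shows "card (verts H) \<ge> 6"
proof -
  obtain v where v: "v \<in> verts G" using assms by blast
  have "Pair v ` {..<6::nat} \<subseteq> verts H" using v by (auto simp: hexagon_graph_def hexagon_verts_def)
  moreover have "finite (verts H)" using simple_H by (simp add: simple_graph_def)
  ultimately have "card (Pair v ` {..<6::nat}) \<le> card (verts H)" by (rule card_mono[rotated])
  then show ?thesis by (simp add: card_image inj_on_def)
qed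

section \<open>The two implications\<close>

lemma brace_if_bridgeless:
  assumes "connected_graph G" "bridgeless G" shows "brace H"
proof -
  have conn: "(u, v) \<in> reachable (delete_edge G {u, v})" if "{u, v} \<in> edges G" for u v
    using not_bridge_reachable[OF simple assms(1) that] assms(2) that unfolding bridgeless_def by blast
  \<comment> \<open>The identity stands for the matching by the antipodal edges inside the
    hexagons.\<close>
  have "dart_matching id" by (auto simp: dart_matching_def)
  then have "\<exists>M. perfect_matching H M" using perfect_matching_of_dart_matching by blast
  moreover have "verts G \<noteq> {}" using assms by (simp add: connected_graph_def)
  ultimately show ?thesis unfolding brace_def
    using simple_H connected_H[OF assms(1)] bipartite_H card_verts_H extend_two_edges[OF conn] by blast
qed

lemma bridgeless_if_brace:
  assumes "brace H" shows "bridgeless G"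
  unfolding bridgeless_def
proof (intro ballI notI)
  fix e assume e: "e \<in> edges G" "bridge G e"
  then obtain u v where uv: "e = {u, v}" using simple by (auto simp: simple_graph_def card_2_iff)
  let ?S = "{(x, y). {x, y} \<in> edges G - {{u, v}}}"
  define U where "U = {w. (u, w) \<in> ?S\<^sup>*}"
  have V: "u \<in> verts G" "v \<in> verts G" "u \<noteq> v" using edge_verts e uv by auto
  have U: "u \<in> U" "v \<notin> U"
    using bridge_not_reachable[of G u v] e uv V
    by (auto simp: U_def reachable_def delete_edge_def)
  \<comment> \<open>The only dart leading from outside \<open>U\<close> into \<open>U\<close> is the
    bridge taken backwards.\<close>
  have cross: "a = v \<and> b = u" if "(a, b) \<in> darts" "a \<notin> U" "b \<in> U" for a b
  proof (rule ccontr)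
    assume "\<not> (a = v \<and> b = u)"
    moreover have "\<not> (a = u \<and> b = v)" using that U by auto
    ultimately have "(b, a) \<in> ?S" using that(1) by (auto simp: darts_def insert_commute doubleton_eq_iff)
    then show False using that(2,3) unfolding U_def by (auto intro: rtrancl.rtrancl_into_rtrancl)
  qed
  have "neighbours G u \<noteq> {v}" using card_neighbours[OF V(1)] by auto
  moreover have "v \<in> neighbours G u" using e uv by (simp add: neighbours_def insert_commute)
  ultimately obtain w where w: "w \<in> neighbours G u" "w \<noteq> v" by blast
  have D: "(u, v) \<in> darts" "(v, u) \<in> darts" "(u, w) \<in> darts"
    using e uv w by (auto simp: darts_def neighbours_def insert_commute)
  have "{xport (u, v), yport (v, u)} \<in> edges H" "{xport (u, w), yport (u, v)} \<in> edges H"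
    using D by (auto intro!: edge_H_I)
  \<comment> \<open>\<open>w\<close> differs from \<open>v\<close>, so the even ends differ;
    \<open>u\<close> differs from \<open>v\<close>, so the odd ends do.\<close>
  moreover have "{xport (u, v), yport (v, u)} \<inter> {xport (u, w), yport (u, v)} = {}"
    using D w(2) V(3) xport_neq_yport xport_eq_iff yport_eq_iff xport_neq_yport[symmetric] by auto
  ultimately obtain M where M: "perfect_matching H M" "{xport (u, v), yport (v, u)} \<in> M"
    "{xport (u, w), yport (u, v)} \<in> M"
    using assms unfolding brace_def by blast
  obtain p where p: "dart_matching p"
    "\<And>d d'. d \<in> darts \<Longrightarrow> d' \<in> darts \<Longrightarrow> {xport d, yport d'} \<in> M \<Longrightarrow> p d = d'"
    using dart_matching_of_perfect_matching[OF M(1)] by blast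
  have puv: "p (u, v) = (v, u)" "p (u, w) = (u, v)" using p(2) M D by auto
  define C where "C = {d \<in> darts. fst d \<notin> U}"
  have inj: "inj_on p darts" using p(1) by (simp add: dart_matching_def)
  \<comment> \<open>A dart of \<open>C\<close> could leave \<open>C\<close> only by reversing
    \<open>(v, u)\<close>, but the value \<open>(u, v)\<close> is already taken by
    \<open>(u, w)\<close>.\<close>
  have "p d \<in> C" if d: "d \<in> C" for d
  proof (rule ccontr)
    assume n: "p d \<notin> C"
    have d': "d \<in> darts" "fst d \<notin> U" "p d \<in> darts" "linked d (p d)"
      using d p(1) by (auto simp: C_def dart_matching_def)
    then have "p d = prod.swap d" "fst (p d) \<in> U" using n by (auto simp: C_def)
    then have "d = (v, u)" "p d = (u, v)" using cross[of "fst d" "snd d"] d' by (auto simp: prod_eq_iff)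
    then have "d = (u, w)" using inj d'(1) D(3) puv(2) by (metis inj_onD)
    then show False using \<open>d = (v, u)\<close> V(3) by simp
  qed
  moreover have "finite C" "inj_on p C"
    using finite_darts inj by (auto simp: C_def intro: inj_on_subset)
  \<comment> \<open>By finiteness \<open>p\<close> maps \<open>C\<close> onto itself, so
    \<open>(v, u)\<close> has a preimage in \<open>C\<close>; yet its preimage is
    \<open>(u, v)\<close>, whose tail lies in \<open>U\<close>.\<close>
  ultimately have "p ` C = C" by (intro endo_inj_surj) auto
  moreover have "(v, u) \<in> C" using D U by (simp add: C_def)
  ultimately obtain d where d: "d \<in> C" "p d = (v, u)" by (metis imageE)
  then have "d = (u, v)" using inj_onD[OF inj, of d "(u, v)"] D(1) puv(1) by (simp add: C_def)
  then show False using d U by (simp add: C_def)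
qed

end

text \<open>A brace is connected by definition, so the equivalence fails for a bridgeless
  \<open>G\<close> that is disconnected or empty; the implication from brace to bridgeless is stated
  for every cubic \<open>G\<close>.\<close>

theorem theorem6:
  fixes G :: "'a ugraph" and H :: "('a \<times> nat) ugraph"
  assumes "simple_graph G"
    and "cubic G"
    and "is_hexagon_graph G H"
  shows "(connected_graph G \<longrightarrow> (brace H \<longleftrightarrow> bridgeless G)) \<and> (brace H \<longrightarrow> bridgeless G)"
proof -
  obtain ix where assign: "index_assignment G ix" "H = hexagon_graph G ix"
    using assms(3) by (auto simp: is_hexagon_graph_def)
  interpret hexagonal G ix using assms assign by unfold_locales
  show ?thesis using brace_if_bridgeless bridgeless_if_brace assign(2) by blast
qed

end
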